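(* Let $q=\exp(2\pi i/3)$ and let $\mathfrak T^3$ be the complex vector space of third-order hypermatrices $T=(T_{ijk})_{i,j,k\in\{1,2,3\}}$, $T_{ijk}\in\mathbb C$, equipped with the ternary multiplication $(T\diamond U\diamond V)_{ijk}=\sum_{p,r,s=1}^3 T_{ijp}\,U_{rsp}\,V_{srk}$. Let $U\in\mathfrak T^3$ be a traceless $q$-cyclic hypermatrix that is $I_2$-regular, i.e. $I_2(U)\neq 0$. Then the hypermatrix $$\hat U=\sqrt{\frac{3}{q\,I_2(U)}}\;U$$ is a right biunit of the ternary algebra $(\mathfrak T^3,\diamond)$, that is, for every $T\in\mathfrak T^3$ we have $T\diamond\hat U\diamond\hat U=T$.
   Context: All indices run over $\{1,2,3\}$. A hypermatrix $T\in\mathfrak T^3$ is called traceless if the trace over any pair of indices vanishes: for every $j$, $\sum_i T_{iij}=0$, $\sum_i T_{iji}=0$, $\sum_i T_{jii}=0$. It is called $q$-cyclic if $T_{ijk}=q\,T_{jki}$ for all $i,j,k$. The quadratic invariant $I_2$ is $I_2(T)=\sum_{i,j,k}T_{ijk}T_{ikj}$, and $T$ is called $I_2$-regular if $I_2(T)\neq 0$. The square root denotes a complex number whose square is $3/(q\,I_2(U))$ (either choice). *)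

theory Defs
  imports "HOL-Analysis.Analysis"
begin

text \<open>
  The index set is the three-element type \<open>3\<close>, whose elements are \<open>1\<close>, \<open>2\<close> and \<open>3 = 0\<close>.
  The component \<open>T\<^sub>i\<^sub>j\<^sub>k\<close> is \<open>T $ i $ j $ k\<close>.
\<close>

type_synonym hypermatrix = "complex ^ 3 ^ 3 ^ 3"

text \<open>
  The library provides only real scaling on this type, and \<open>*s\<close> scales by
  elements of the entry type \<open>complex ^ 3 ^ 3\<close>.
\<close>

definition hscale :: "complex \<Rightarrow> hypermatrix \<Rightarrow> hypermatrix" where
  "hscale c T = (\<chi> i j k. c * T $ i $ j $ k)"

definition tmult :: "hypermatrix \<Rightarrow> hypermatrix \<Rightarrow> hypermatrix \<Rightarrow> hypermatrix" where
  "tmult T U V =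
    (\<chi> i j k. \<Sum>p\<in>UNIV. \<Sum>r\<in>UNIV. \<Sum>s\<in>UNIV. T $ i $ j $ p * U $ r $ s $ p * V $ s $ r $ k)"

definition traceless :: "hypermatrix \<Rightarrow> bool" where
  "traceless T \<longleftrightarrow>
    (\<forall>j. (\<Sum>i\<in>UNIV. T $ i $ i $ j) = 0 \<and> (\<Sum>i\<in>UNIV. T $ i $ j $ i) = 0 \<and>
         (\<Sum>i\<in>UNIV. T $ j $ i $ i) = 0)"

definition q_cyclic :: "complex \<Rightarrow> hypermatrix \<Rightarrow> bool" where
  "q_cyclic q T \<longleftrightarrow> (\<forall>i j k. T $ i $ j $ k = q * T $ j $ k $ i)"

definition I2 :: "hypermatrix \<Rightarrow> complex" where
  "I2 T = (\<Sum>i\<in>UNIV. \<Sum>j\<in>UNIV. \<Sum>k\<in>UNIV. T $ i $ j $ k * T $ i $ k $ j)"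

definition I2_regular :: "hypermatrix \<Rightarrow> bool" where
  "I2_regular T \<longleftrightarrow> I2 T \<noteq> 0"

definition right_biunit :: "hypermatrix \<Rightarrow> bool" where
  "right_biunit E \<longleftrightarrow> (\<forall>T. tmult T E E = T)"

end

theory Submission
  imports Defs
begin

text \<open>
  A traceless \<open>q\<close>-cyclic \<open>U\<close> is determined by the five entries \<open>U\<^sub>2\<^sub>2\<^sub>1\<close>, \<open>U\<^sub>1\<^sub>1\<^sub>2\<close>, \<open>U\<^sub>1\<^sub>1\<^sub>3\<close>,
  \<open>U\<^sub>1\<^sub>2\<^sub>3\<close> and \<open>U\<^sub>1\<^sub>3\<^sub>2\<close>. In these coordinates \<open>1 + q + q\<^sup>2 = 0\<close> makes the matrix
  \<open>M\<^sub>p\<^sub>k = \<Sum>\<^sub>r\<^sub>s U\<^sub>r\<^sub>s\<^sub>p U\<^sub>s\<^sub>r\<^sub>k\<close> scalar, and its trace is \<open>q I\<^sub>2(U)\<close> by cyclicity. Right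
  multiplication by \<open>U, U\<close> multiplies the last index of \<open>T\<close> by \<open>M\<close>, so it is the
  scaling by \<open>q I\<^sub>2(U) / 3\<close>.
\<close>

lemma exp_third_root: "exp (2 * of_real pi * \<i> / 3) = Complex (-1/2) (sqrt 3 / 2)"
proof -
  have "exp (2 * of_real pi * \<i> / 3) = cis (2 * pi / 3)"
    by (simp add: cis_conv_exp mult_ac)
  then show ?thesis
    by (simp add: complex_eq_iff cos_120 sin_120)
qed

text \<open>The relation 1 + q + q^2 = 0, oriented as a rewrite rule that lowers the degree in
  \<open>q\<close>.\<close>

lemma exp_third_root_square:
  assumes "q = exp (2 * of_real pi * \<i> / 3)"
  shows "q * q = - 1 - q"
  unfolding assms exp_third_root by (simp add: complex_eq_iff)

text \<open>Cyclicity fixes each diagonal entry up to the factor \<open>q\<close>, and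
  \<open>q\<close> is not 1, so these entries vanish. Each trace over the first two indices then has
  only two terms left, which are opposite.\<close>

lemma traceless_q_cyclic_entries:
  assumes q: "q * q = - 1 - q" and tr: "traceless U" and cyc: "q_cyclic q U"
  shows "U $ i $ i $ i = 0"
    and "U $ k $ i $ j = q * U $ i $ j $ k"
    and "U $ 3 $ 3 $ 1 = - U $ 2 $ 2 $ 1"
    and "U $ 3 $ 3 $ 2 = - U $ 1 $ 1 $ 2"
    and "U $ 2 $ 2 $ 3 = - U $ 1 $ 1 $ 3"
proof -
  show cyc': "U $ k $ i $ j = q * U $ i $ j $ k" for i j k
    using cyc unfolding q_cyclic_def by blast
  have "q \<noteq> 1"
    using q by auto
  then show diag: "U $ i $ i $ i = 0" for i
    using cyc'[of i i i] by simp
  have "(\<Sum>i\<in>UNIV. U $ i $ i $ j) = 0" for j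
    using tr unfolding traceless_def by blast
  then have tr: "U $ 1 $ 1 $ j + U $ 2 $ 2 $ j + U $ 3 $ 3 $ j = 0" for j
    by (simp add: sum_3)
  show "U $ 3 $ 3 $ 1 = - U $ 2 $ 2 $ 1" "U $ 3 $ 3 $ 2 = - U $ 1 $ 1 $ 2"
    "U $ 2 $ 2 $ 3 = - U $ 1 $ 1 $ 3"
    using tr[of 1] tr[of 2] tr[of 3] diag by (simp_all add: eq_neg_iff_add_eq_0 add_ac)
qed

lemma traceless_q_cyclic_contraction:
  assumes q: "q * q = - 1 - q" and "traceless U" and "q_cyclic q U"
  shows "(\<Sum>r\<in>UNIV. \<Sum>s\<in>UNIV. U $ r $ s $ p * U $ s $ r $ k) = (if p = k then q * I2 U / 3 else 0)"
proof -
  note entries = traceless_q_cyclic_entries[OF assms]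
  define x y z a b where "x = U $ 2 $ 2 $ 1" and "y = U $ 1 $ 1 $ 2" and "z = U $ 1 $ 1 $ 3"
    and "a = U $ 1 $ 2 $ 3" and "b = U $ 1 $ 3 $ 2"
  note coords = x_def[symmetric] y_def[symmetric] z_def[symmetric] a_def[symmetric] b_def[symmetric]
  \<comment> \<open>Variant of \<open>q\<close> matching inside the right-nested products that
    \<open>algebra_simps\<close> produces.\<close>
  have qq: "q * (q * w) = - w - q * w" for w
    by (simp only: mult.assoc[symmetric] q) (simp add: algebra_simps)
  \<comment> \<open>The general rotation rule would loop under rewriting, so only instances leading
    towards the chosen representative of each orbit are used.\<close>
  have rot: "U $ 2 $ 1 $ 1 = q * y" "U $ 1 $ 2 $ 1 = q * (q * y)"
    "U $ 3 $ 1 $ 1 = q * z" "U $ 1 $ 3 $ 1 = q * (q * z)"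
    "U $ 1 $ 2 $ 2 = q * x" "U $ 2 $ 1 $ 2 = q * (q * x)"
    "U $ 3 $ 2 $ 2 = - q * z" "U $ 2 $ 3 $ 2 = - q * (q * z)"
    "U $ 1 $ 3 $ 3 = - q * x" "U $ 3 $ 1 $ 3 = - q * (q * x)"
    "U $ 2 $ 3 $ 3 = - q * y" "U $ 3 $ 2 $ 3 = - q * (q * y)"
    "U $ 3 $ 1 $ 2 = q * a" "U $ 2 $ 3 $ 1 = q * (q * a)"
    "U $ 2 $ 1 $ 3 = q * b" "U $ 3 $ 2 $ 1 = q * (q * b)"
    by (simp_all only: entries(2)[of 2 1 1] entries(2)[of 1 2 1] entries(2)[of 3 1 1] entries(2)[of 1 3 1]
      entries(2)[of 1 2 2] entries(2)[of 2 1 2] entries(2)[of 3 2 2] entries(2)[of 2 3 2]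
      entries(2)[of 1 3 3] entries(2)[of 3 1 3] entries(2)[of 2 3 3] entries(2)[of 3 2 3]
      entries(2)[of 3 1 2] entries(2)[of 2 3 1] entries(2)[of 2 1 3] entries(2)[of 3 2 1]
      entries(3-5) coords mult_minus_left mult_minus_right)
  note vals = rot entries(1) entries(3-5)[unfolded coords] coords
  have "\<forall>p k. (\<Sum>r\<in>UNIV. \<Sum>s\<in>UNIV. U $ r $ s $ p * U $ s $ r $ k) =
      (if p = k then 2 * (x * x + y * y + z * z + q * (a * b)) else 0)"
    unfolding forall_3 sum_3 vals by (simp add: algebra_simps qq q)
  moreover have "q * I2 U = 6 * (x * x + y * y + z * z + q * (a * b))"
    unfolding I2_def sum_3 vals by (simp add: algebra_simps qq q)
  ultimately show ?thesis
    by simp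
qed

text \<open>Only \<open>c ^ 2\<close> enters, so either choice of the square root works.\<close>

lemma tmult_hscale_hscale: "tmult T (hscale c U) (hscale c U) = hscale (c ^ 2) (tmult T U U)"
  by (simp add: vec_eq_iff tmult_def hscale_def sum_distrib_left power2_eq_square mult_ac)

lemma tmult_scalar_contraction:
  assumes "\<And>p k. (\<Sum>r\<in>UNIV. \<Sum>s\<in>UNIV. U $ r $ s $ p * V $ s $ r $ k) = (if p = k then m else 0)"
  shows "tmult T U V = hscale m T"
proof -
  have "(\<Sum>p\<in>UNIV. \<Sum>r\<in>UNIV. \<Sum>s\<in>UNIV. T $ i $ j $ p * U $ r $ s $ p * V $ s $ r $ k) =
      m * T $ i $ j $ k" for i j k
  proof -
    have "(\<Sum>p\<in>UNIV. \<Sum>r\<in>UNIV. \<Sum>s\<in>UNIV. T $ i $ j $ p * U $ r $ s $ p * V $ s $ r $ k) =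
        (\<Sum>p\<in>UNIV. T $ i $ j $ p * (\<Sum>r\<in>UNIV. \<Sum>s\<in>UNIV. U $ r $ s $ p * V $ s $ r $ k))"
      by (simp add: sum_distrib_left mult.assoc)
    also have "\<dots> = m * T $ i $ j $ k"
      by (simp add: assms if_distrib mult.commute cong: if_cong)
    finally show ?thesis .
  qed
  then show ?thesis
    by (simp add: vec_eq_iff tmult_def hscale_def)
qed

theorem theorem2:
  fixes q c :: complex and U :: hypermatrix
  assumes "q = exp (2 * of_real pi * \<i> / 3)"
    and "traceless U"
    and "q_cyclic q U"
    and "I2_regular U"
    and "c ^ 2 = 3 / (q * I2 U)"
  shows "right_biunit (hscale c U)"
proof -
  have "q \<noteq> 0" "I2 U \<noteq> 0"
    using assms(1,4) by (auto simp: I2_regular_def)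
  have contract: "tmult T U U = hscale (q * I2 U / 3) T" for T
    by (intro tmult_scalar_contraction traceless_q_cyclic_contraction
        exp_third_root_square assms)
  have "hscale (c ^ 2) (tmult T U U) = T" for T
    unfolding contract assms(5) using \<open>q \<noteq> 0\<close> \<open>I2 U \<noteq> 0\<close> by (simp add: hscale_def vec_eq_iff)
  then show ?thesis
    by (simp add: right_biunit_def tmult_hscale_hscale)
qed

end
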